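(* Let $(X_k)_{k\ge 1}$ be a sequence of real-valued random variables on a probability space $(\Omega,\mathcal{K},P_X)$, and let $Y$ be a real-valued random variable such that, for some constant $M>0$, $$\frac1n\sum_{k=1}^n P(|X_k|>x)\le M\,P(|Y|>x)\quad\text{for all } x>0 \text{ and all integers } n\ge 1.$$ Let $1\le p<2$. If $E|Y|^p<\infty$, then $$n^{1/2-1/p}\, E_{\tilde\theta_n}|S_n(\tilde\theta_n)|\to 0\quad P_X\text{-almost surely as } n\to\infty.$$
   Context: For $n\ge 2$, $\tilde\theta_n=(\theta_{n,1},\dots,\theta_{n,n})$ is a random vector distributed uniformly on the unit sphere $\mathbb{S}^{n-1}\subset\mathbb{R}^n$ (i.e. according to the unique rotationally invariant probability measure $P_{\tilde\theta_n}$ on $\mathbb{S}^{n-1}$), independent of $(X_1,\dots,X_n)$, and $S_n(\tilde\theta_n)=\theta_{n,1}X_1+\cdots+\theta_{n,n}X_n$. The symbol $E_{\tilde\theta_n}$ denotes expectation with respect to $P_{\tilde\theta_n}$ only, so that $E_{\tilde\theta_n}|S_n(\tilde\theta_n)|$ is the random variable on $\Omega$ given by $\omega\mapsto\int_{\mathbb{S}^{n-1}}\left|\sum_{k=1}^n u_kX_k(\omega)\right| dP_{\tilde\theta_n}(u)$. No independence among the $X_k$ is assumed. *)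

theory Defs
  imports "HOL-Probability.Probability"
begin

text \<open>
  Since the dimension varies in the limit, a vector of \<open>\<real>\<^sup>n\<close> is an extensional
  function on \<open>{1..n}\<close>, and the Borel structure of \<open>\<real>\<^sup>n\<close> is the finite product of
  the Borel structures of the coordinates.
\<close>

definition unit_sphere :: "nat \<Rightarrow> (nat \<Rightarrow> real) set" where
  "unit_sphere n = {u \<in> {1..n} \<rightarrow>\<^sub>E UNIV. (\<Sum>k=1..n. (u k)\<^sup>2) = 1}"

definition sphere_borel :: "nat \<Rightarrow> (nat \<Rightarrow> real) measure" where
  "sphere_borel n = restrict_space (Pi\<^sub>M {1..n} (\<lambda>_. borel)) (unit_sphere n)"

definition orthogonal_mat :: "nat \<Rightarrow> (nat \<Rightarrow> nat \<Rightarrow> real) \<Rightarrow> bool" where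
  "orthogonal_mat n A \<longleftrightarrow>
     (\<forall>i\<in>{1..n}. \<forall>j\<in>{1..n}. (\<Sum>k=1..n. A k i * A k j) = (if i = j then 1 else 0))"

definition mat_app :: "nat \<Rightarrow> (nat \<Rightarrow> nat \<Rightarrow> real) \<Rightarrow> (nat \<Rightarrow> real) \<Rightarrow> (nat \<Rightarrow> real)" where
  "mat_app n A u = (\<lambda>i\<in>{1..n}. \<Sum>j=1..n. A i j * u j)"

text \<open>
  Rotational invariance means invariance under the orthogonal group; for \<open>n \<ge> 2\<close>
  there is exactly one such probability measure, and it is also the only one
  invariant under the special orthogonal group.
\<close>

definition uniform_on_sphere :: "nat \<Rightarrow> (nat \<Rightarrow> real) measure \<Rightarrow> bool" where
  "uniform_on_sphere n \<mu> \<longleftrightarrow>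
     prob_space \<mu> \<and>
     sets \<mu> = sets (sphere_borel n) \<and>
     (\<forall>A. orthogonal_mat n A \<longrightarrow> distr \<mu> (sphere_borel n) (mat_app n A) = \<mu>)"

definition weighted_sum :: "(nat \<Rightarrow> 'a \<Rightarrow> real) \<Rightarrow> nat \<Rightarrow> (nat \<Rightarrow> real) \<Rightarrow> 'a \<Rightarrow> real" where
  "weighted_sum X n u \<omega> = (\<Sum>k=1..n. u k * X k \<omega>)"

end

theory Submission
  imports Defs "HOL-Combinatorics.Permutations"
begin

text \<open>
  By Jensen, \<open>E|S\<^sub>n| \<le> (E S\<^sub>n\<^sup>2)\<^sup>1\<^sup>/\<^sup>2\<close>, and the second moment over the sphere is
  \<open>(1/n) (X\<^sub>1\<^sup>2 + \<dots> + X\<^sub>n\<^sup>2)\<close>; so with \<open>q = 2/p > 1\<close> it suffices that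
  \<open>n\<^sup>-\<^sup>q (X\<^sub>1\<^sup>2 + \<dots> + X\<^sub>n\<^sup>2)\<close> tends to \<open>0\<close> almost surely. Along \<open>n = 2\<^sup>j\<close> consider the sums
  \<open>U\<^sub>j\<close> of \<open>min 1 (X\<^sub>k\<^sup>2 / 2\<^sup>q\<^sup>j)\<close> over \<open>k \<le> 2\<^sup>j\<close>. The tail hypothesis bounds \<open>E U\<^sub>j\<close> by
  \<open>M 2\<^sup>j E min 1 (Y\<^sup>2 / 2\<^sup>q\<^sup>j)\<close>, and the latter are summable in \<open>j\<close> because
  \<open>E |Y|\<^sup>p\<close> is finite. Hence \<open>U\<^sub>j\<close> tends to \<open>0\<close> almost surely. Once \<open>U\<^sub>j < 1\<close>, none of its
  terms is truncated, so no independence and no separate Borel--Cantelli step is needed.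
\<close>

section \<open>Second moments on the sphere\<close>

lemma sum_mult_delta_permutes:
  fixes f :: "nat \<Rightarrow> real"
  assumes "\<pi> permutes A" "finite A" "i \<in> A"
  shows "(\<Sum>k\<in>A. if i = \<pi> k then f k else 0) = f (inv \<pi> i)"
proof -
  have "(i = \<pi> k) = (k = inv \<pi> i)" for k
    using permutes_inverses[OF assms(1)] by metis
  moreover have "inv \<pi> i \<in> A"
    using permutes_in_image[OF permutes_inv[OF assms(1)]] assms(3) by simp
  ultimately show ?thesis
    using assms(2) by simp
qed

text \<open>Coordinate permutations with sign changes are the only orthogonal maps used below: sign
  flips kill the mixed second moments, and swaps equate the pure ones.\<close>

definition signed_perm :: "nat \<Rightarrow> (nat \<Rightarrow> nat) \<Rightarrow> (nat \<Rightarrow> real) \<Rightarrow> (nat \<Rightarrow> real) \<Rightarrow> (nat \<Rightarrow> real)" where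
  "signed_perm n \<pi> s u = (\<lambda>i\<in>{1..n}. s i * u (\<pi> i))"

text \<open>Each row and each column of \<open>A\<close> has exactly one nonzero entry, a sign. This
  makes the invariance assumed for orthogonal matrices applicable to
  \<open>signed_perm\<close>.\<close>

lemma signed_perm_matrix:
  fixes s :: "nat \<Rightarrow> real"
  assumes \<pi>: "\<pi> permutes {1..n}" and s: "\<And>i. (s i)\<^sup>2 = 1"
  defines "A \<equiv> \<lambda>i j. if j = \<pi> i then s i else 0"
  shows "orthogonal_mat n A" and "mat_app n A = signed_perm n \<pi> s"
proof -
  show "orthogonal_mat n A"
    unfolding orthogonal_mat_def
  proof (intro ballI)
    fix i j assume i: "i \<in> {1..n}" and "j \<in> {1..n}"
    have "(\<Sum>k=1..n. A k i * A k j) = (\<Sum>k=1..n. if i = \<pi> k then (if i = j then 1 else 0) else 0)"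
      using s by (intro sum.cong) (auto simp: A_def power2_eq_square)
    also have "\<dots> = (if i = j then 1 else 0)"
      using sum_mult_delta_permutes[OF \<pi> _ i, of "\<lambda>_. if i = j then 1 else 0"] by simp
    finally show "(\<Sum>k=1..n. A k i * A k j) = (if i = j then 1 else 0)" .
  qed
  show "mat_app n A = signed_perm n \<pi> s"
  proof
    fix u
    have "(\<Sum>j=1..n. A i j * u j) = s i * u (\<pi> i)" if "i \<in> {1..n}" for i
    proof -
      have "(\<Sum>j=1..n. A i j * u j) = (\<Sum>j=1..n. if j = \<pi> i then s i * u j else 0)"
        by (intro sum.cong) (auto simp: A_def)
      also have "\<dots> = s i * u (\<pi> i)"
        using permutes_in_image[OF \<pi>, of i] that by simp
      finally show ?thesis .
    qed
    then show "mat_app n A u = signed_perm n \<pi> s u"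
      unfolding mat_app_def signed_perm_def by (intro restrict_ext) auto
  qed
qed

lemma space_sphere_borel: "space (sphere_borel n) = unit_sphere n"
  by (auto simp: sphere_borel_def space_restrict_space space_PiM unit_sphere_def)

lemma measurable_coord_sphere [measurable]:
  "i \<in> {1..n} \<Longrightarrow> (\<lambda>u. u i) \<in> borel_measurable (sphere_borel n)"
  unfolding sphere_borel_def
  by (intro measurable_restrict_space1 measurable_component_singleton)

lemma measurable_signed_perm:
  assumes \<pi>: "\<pi> permutes {1..n}" and s: "\<And>i. (s i)\<^sup>2 = 1"
  shows "signed_perm n \<pi> s \<in> measurable (sphere_borel n) (sphere_borel n)"
proof -
  have "signed_perm n \<pi> s \<in> measurable (sphere_borel n) (Pi\<^sub>M {1..n} (\<lambda>_. borel))"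
    unfolding signed_perm_def using permutes_in_image[OF \<pi>]
    by (intro measurable_restrict borel_measurable_times borel_measurable_const
        measurable_coord_sphere) auto
  moreover have "signed_perm n \<pi> s u \<in> unit_sphere n" if "u \<in> unit_sphere n" for u
  proof -
    have "(\<Sum>k=1..n. (signed_perm n \<pi> s u k)\<^sup>2) = (\<Sum>k=1..n. (u (\<pi> k))\<^sup>2)"
      by (intro sum.cong) (auto simp: signed_perm_def power_mult_distrib s)
    also have "\<dots> = (\<Sum>k=1..n. (u k)\<^sup>2)"
      using sum.permute[OF \<pi>, of "\<lambda>k. (u k)\<^sup>2"] by (simp add: o_def)
    finally show ?thesis
      using that by (auto simp: unit_sphere_def signed_perm_def)
  qed
  ultimately show ?thesis
    by (subst (2) sphere_borel_def)
      (auto intro!: measurable_restrict_space2 simp: space_sphere_borel)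
qed

context
  fixes n :: nat and \<mu> :: "(nat \<Rightarrow> real) measure"
  assumes unif: "uniform_on_sphere n \<mu>"
begin

interpretation prob_space \<mu>
  using unif by (simp add: uniform_on_sphere_def)

private lemma sets_uniform: "sets \<mu> = sets (sphere_borel n)"
  using unif by (simp add: uniform_on_sphere_def)

lemma measurable_coord_uniform:
  "i \<in> {1..n} \<Longrightarrow> (\<lambda>u. u i) \<in> borel_measurable \<mu>"
  unfolding measurable_cong_sets[OF sets_uniform refl] by (rule measurable_coord_sphere)

private lemma space_uniform: "space \<mu> = unit_sphere n"
  using sets_eq_imp_space_eq[OF sets_uniform] by (simp add: space_sphere_borel)

lemma abs_coord_uniform_le_1:
  assumes "u \<in> space \<mu>" "i \<in> {1..n}"
  shows "\<bar>u i\<bar> \<le> 1"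
proof -
  have "(u i)\<^sup>2 \<le> (\<Sum>k=1..n. (u k)\<^sup>2)"
    using assms(2) by (intro member_le_sum) auto
  also have "\<dots> = 1"
    using assms(1) by (simp add: space_uniform unit_sphere_def)
  finally show ?thesis
    by (simp add: abs_square_le_1)
qed

lemma integrable_coord_product_uniform:
  assumes "i \<in> {1..n}" "j \<in> {1..n}"
  shows "integrable \<mu> (\<lambda>u. u i * u j)"
proof (rule integrable_const_bound[where B = 1])
  show "AE u in \<mu>. norm (u i * u j) \<le> 1"
    using abs_coord_uniform_le_1 assms
    by (intro AE_I2) (auto simp: abs_mult intro!: mult_le_one)
qed (use measurable_coord_uniform assms in measurable)

text \<open>Change of variables: the image of \<open>\<mu>\<close> under the map is
  \<open>\<mu>\<close> itself.\<close>

lemma integral_signed_perm_uniform: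
  fixes f :: "(nat \<Rightarrow> real) \<Rightarrow> real"
  assumes \<pi>: "\<pi> permutes {1..n}" and s: "\<And>i. (s i)\<^sup>2 = 1"
    and f: "f \<in> borel_measurable \<mu>"
  shows "(\<integral>u. f (signed_perm n \<pi> s u) \<partial>\<mu>) = (\<integral>u. f u \<partial>\<mu>)"
proof -
  have meas: "signed_perm n \<pi> s \<in> measurable \<mu> (sphere_borel n)"
    unfolding measurable_cong_sets[OF sets_uniform refl] by (rule measurable_signed_perm[OF \<pi> s])
  have fm: "f \<in> borel_measurable (sphere_borel n)"
    using f unfolding measurable_cong_sets[OF sets_uniform refl] .
  have "distr \<mu> (sphere_borel n) (signed_perm n \<pi> s) = \<mu>"
    using unif signed_perm_matrix(1)[OF \<pi> s] signed_perm_matrix(2)[OF \<pi> s, symmetric]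
    by (simp add: uniform_on_sphere_def)
  then show ?thesis
    using integral_distr[OF meas fm] by simp
qed

text \<open>For distinct indices, flipping the sign of coordinate \<open>i\<close> shows that the
  integral equals its own negative. For equal indices, swapping coordinates shows that all
  \<open>n\<close> integrals agree, and they add up to 1 on the sphere.\<close>

lemma integral_coord_product_uniform:
  assumes i: "i \<in> {1..n}" and j: "j \<in> {1..n}"
  shows "(\<integral>u. u i * u j \<partial>\<mu>) = (if i = j then 1 / real n else 0)"
proof (cases "i = j")
  case False
  let ?s = "\<lambda>k. if k = i then -1 else (1::real)"
  have "(\<integral>u. u i * u j \<partial>\<mu>) = (\<integral>u. signed_perm n id ?s u i * signed_perm n id ?s u j \<partial>\<mu>)"
    using i j measurable_coord_uniform
    by (intro integral_signed_perm_uniform[symmetric] permutes_id borel_measurable_times) auto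
  also have "\<dots> = (\<integral>u. - (u i * u j) \<partial>\<mu>)"
    using i j False by (simp add: signed_perm_def)
  finally show ?thesis
    using False by simp
next
  case True
  have eq: "(\<integral>u. u k * u k \<partial>\<mu>) = (\<integral>u. u i * u i \<partial>\<mu>)" if k: "k \<in> {1..n}" for k
  proof -
    let ?\<pi> = "Transposition.transpose i k"
    have "(\<integral>u. u i * u i \<partial>\<mu>) =
        (\<integral>u. signed_perm n ?\<pi> (\<lambda>_. 1) u i * signed_perm n ?\<pi> (\<lambda>_. 1) u i \<partial>\<mu>)"
      using i k measurable_coord_uniform
      by (intro integral_signed_perm_uniform[symmetric] permutes_swap_id borel_measurable_times) auto
    also have "\<dots> = (\<integral>u. u k * u k \<partial>\<mu>)"
      using i k by (simp add: signed_perm_def)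
    finally show ?thesis by simp
  qed
  have "1 = (\<integral>u. (\<Sum>k=1..n. u k * u k) \<partial>\<mu>)"
  proof -
    have "(\<integral>u. (\<Sum>k=1..n. u k * u k) \<partial>\<mu>) = (\<integral>u. 1 \<partial>\<mu>)"
      by (intro Bochner_Integration.integral_cong refl)
        (simp add: space_uniform unit_sphere_def power2_eq_square)
    then show ?thesis by (simp add: prob_space)
  qed
  also have "\<dots> = (\<Sum>k=1..n. \<integral>u. u k * u k \<partial>\<mu>)"
    by (intro Bochner_Integration.integral_sum integrable_coord_product_uniform)
  also have "\<dots> = (\<Sum>k=1..n. \<integral>u. u i * u i \<partial>\<mu>)"
    using eq by (intro sum.cong) auto
  also have "\<dots> = real n * (\<integral>u. u i * u i \<partial>\<mu>)"
    by simp
  finally show ?thesis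
    using True i by (simp add: field_simps)
qed

text \<open>In the expanded square only the diagonal terms survive integration, each with weight
  \<open>1 / n\<close>.\<close>

lemma second_moment_uniform:
  fixes x :: "nat \<Rightarrow> real"
  shows "integrable \<mu> (\<lambda>u. (\<Sum>k=1..n. u k * x k)\<^sup>2)"
    and "(\<integral>u. (\<Sum>k=1..n. u k * x k)\<^sup>2 \<partial>\<mu>) = (\<Sum>k=1..n. (x k)\<^sup>2) / real n"
proof -
  have expand: "(\<Sum>k=1..n. u k * x k)\<^sup>2 = (\<Sum>i=1..n. \<Sum>j=1..n. x i * x j * (u i * u j))" for u
    by (simp add: power2_eq_square sum_product algebra_simps)
  have int: "integrable \<mu> (\<lambda>u. x i * x j * (u i * u j))" if "i \<in> {1..n}" "j \<in> {1..n}" for i j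
    using integrable_coord_product_uniform[OF that] by simp
  show "integrable \<mu> (\<lambda>u. (\<Sum>k=1..n. u k * x k)\<^sup>2)"
    unfolding expand using int by (intro Bochner_Integration.integrable_sum) auto
  have "(\<integral>u. (\<Sum>k=1..n. u k * x k)\<^sup>2 \<partial>\<mu>)
      = (\<Sum>i=1..n. \<Sum>j=1..n. \<integral>u. x i * x j * (u i * u j) \<partial>\<mu>)"
    unfolding expand using int
    by (subst Bochner_Integration.integral_sum,
        force intro: Bochner_Integration.integrable_sum)
      (intro sum.cong refl Bochner_Integration.integral_sum, auto)
  also have "\<dots> = (\<Sum>i=1..n. \<Sum>j=1..n. if i = j then x i * x j / real n else 0)"
    using integral_coord_product_uniform by (intro sum.cong refl) auto
  also have "\<dots> = (\<Sum>k=1..n. (x k)\<^sup>2) / real n"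
    by (simp add: power2_eq_square sum_divide_distrib)
  finally show "(\<integral>u. (\<Sum>k=1..n. u k * x k)\<^sup>2 \<partial>\<mu>) = (\<Sum>k=1..n. (x k)\<^sup>2) / real n" .
qed

lemma first_moment_uniform_le:
  fixes x :: "nat \<Rightarrow> real"
  shows "(\<integral>u. \<bar>\<Sum>k=1..n. u k * x k\<bar> \<partial>\<mu>) \<le> sqrt ((\<Sum>k=1..n. (x k)\<^sup>2) / real n)"
proof -
  let ?f = "\<lambda>u. \<bar>\<Sum>k=1..n. u k * x k\<bar>"
  have meas: "?f \<in> borel_measurable \<mu>"
    using measurable_coord_uniform by measurable
  have int2: "integrable \<mu> (\<lambda>u. (?f u)\<^sup>2)"
    using second_moment_uniform(1) by simp
  have int: "integrable \<mu> ?f"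
    using square_integrable_imp_integrable[OF meas int2] .
  \<comment> \<open>Jensen's inequality for the square, in the form that a variance is
    nonnegative.\<close>
  have "0 \<le> variance ?f"
    by (rule variance_positive)
  also have "\<dots> = expectation (\<lambda>u. (?f u)\<^sup>2) - (expectation ?f)\<^sup>2"
    by (rule variance_eq[OF int int2])
  finally show ?thesis
    using second_moment_uniform(2) by (intro real_le_rsqrt) simp
qed

end

section \<open>Truncated moments under domination in mean\<close>

text \<open>Write \<open>f x\<close> as the length of the interval from 0 to \<open>f x\<close> and
  exchange the integrals. Since \<open>f\<close> is at most 1, only levels \<open>t\<close> in the
  open unit interval contribute.\<close>

lemma nn_integral_layer_cake_unit:
  fixes f :: "'a \<Rightarrow> real"
  assumes "prob_space N" and [measurable]: "f \<in> borel_measurable N"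
    and f01: "\<And>x. 0 \<le> f x" "\<And>x. f x \<le> 1"
  shows "(\<integral>\<^sup>+x. ennreal (f x) \<partial>N) =
    (\<integral>\<^sup>+t. ennreal (measure N {x \<in> space N. f x > t}) * indicator {0<..<1} t \<partial>lborel)"
proof -
  interpret prob_space N by fact
  interpret pair_sigma_finite N lborel
    by (intro pair_sigma_finite.intro sigma_finite_measure_axioms lborel.sigma_finite_measure_axioms)
  have "(\<integral>\<^sup>+x. ennreal (f x) \<partial>N) = (\<integral>\<^sup>+x. \<integral>\<^sup>+t. indicator {0<..<f x} t \<partial>lborel \<partial>N)"
    using f01 by simp
  \<comment> \<open>The conditional form makes joint measurability in \<open>x\<close> and
    \<open>t\<close> evident, which the exchange of integrals requires.\<close>
  also have "\<dots> = (\<integral>\<^sup>+x. \<integral>\<^sup>+t. (if 0 < t \<and> t < f x then 1 else 0) \<partial>lborel \<partial>N)"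
    by (intro nn_integral_cong) (auto simp: indicator_def)
  also have "\<dots> = (\<integral>\<^sup>+t. \<integral>\<^sup>+x. (if 0 < t \<and> t < f x then 1 else 0) \<partial>N \<partial>lborel)"
    by (intro Fubini'[symmetric]) measurable
  also have "\<dots> = (\<integral>\<^sup>+t. ennreal (measure N {x \<in> space N. f x > t}) * indicator {0<..<1} t \<partial>lborel)"
  proof (intro nn_integral_cong)
    fix t :: real
    show "(\<integral>\<^sup>+x. (if 0 < t \<and> t < f x then 1 else 0) \<partial>N) =
        ennreal (measure N {x \<in> space N. f x > t}) * indicator {0<..<1} t"
    proof (cases "t \<in> {0<..<1}")
      case True
      then have "(\<integral>\<^sup>+x. (if 0 < t \<and> t < f x then 1 else 0) \<partial>N) =
          (\<integral>\<^sup>+x. indicator {x \<in> space N. f x > t} x \<partial>N)"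
        by (intro nn_integral_cong) (auto simp: indicator_def)
      then show ?thesis
        using True by (simp add: emeasure_eq_measure)
    next
      case False
      then have "(\<integral>\<^sup>+x. (if 0 < t \<and> t < f x then 1 else 0) \<partial>N) = (\<integral>\<^sup>+x. 0 \<partial>N)"
        using f01(2) by (intro nn_integral_cong) (auto dest: less_le_trans)
      then show ?thesis
        using False by simp
    qed
  qed
  finally show ?thesis .
qed

text \<open>For \<open>t\<close> strictly between 0 and 1, the truncated square exceeds
  \<open>t\<close> exactly when \<open>\<bar>Z x\<bar>\<close> exceeds \<open>sqrt (c * t)\<close>.
  The moment is thus expressed by the tails that the domination hypothesis controls.\<close>

lemma nn_integral_truncated_square:
  fixes Z :: "'a \<Rightarrow> real"
  assumes "prob_space N" and [measurable]: "Z \<in> borel_measurable N" and c: "c > 0"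
  shows "(\<integral>\<^sup>+x. ennreal (min 1 ((Z x)\<^sup>2 / c)) \<partial>N) =
    (\<integral>\<^sup>+t. ennreal (measure N {x \<in> space N. \<bar>Z x\<bar> > sqrt (c * t)}) * indicator {0<..<1} t \<partial>lborel)"
proof -
  have iff: "(t < min 1 ((Z x)\<^sup>2 / c)) = (sqrt (c * t) < \<bar>Z x\<bar>)" if "t \<in> {0<..<1}" for t x
  proof -
    have "(sqrt (c * t) < \<bar>Z x\<bar>) = (sqrt (c * t) < sqrt ((Z x)\<^sup>2))"
      by simp
    also have "\<dots> = (c * t < (Z x)\<^sup>2)"
      by (rule real_sqrt_less_iff)
    finally show ?thesis
      using that c by (auto simp: field_simps)
  qed
  have "(\<integral>\<^sup>+x. ennreal (min 1 ((Z x)\<^sup>2 / c)) \<partial>N) =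
    (\<integral>\<^sup>+t. ennreal (measure N {x \<in> space N. min 1 ((Z x)\<^sup>2 / c) > t}) * indicator {0<..<1} t \<partial>lborel)"
    using c by (intro nn_integral_layer_cake_unit assms(1)) auto
  also have "\<dots> = (\<integral>\<^sup>+t. ennreal (measure N {x \<in> space N. \<bar>Z x\<bar> > sqrt (c * t)})
      * indicator {0<..<1} t \<partial>lborel)"
    using iff by (intro nn_integral_cong) (auto simp: indicator_def simp del: min_less_iff_conj)
  finally show ?thesis .
qed

text \<open>Both sides are integrals over \<open>t\<close> of tail probabilities, so the averaged
  tail bound at the positive level \<open>sqrt (c * t)\<close> can be integrated. Only marginal
  distributions enter.\<close>

lemma sum_truncated_square_le:
  fixes X :: "nat \<Rightarrow> 'a \<Rightarrow> real" and Y :: "'b \<Rightarrow> real"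
  assumes N: "prob_space N" and X: "\<And>k. k \<ge> 1 \<Longrightarrow> X k \<in> borel_measurable N"
    and N': "prob_space N'" and Y: "Y \<in> borel_measurable N'"
    and "M > 0" and "n \<ge> 1" and "c > 0"
    and dom: "\<And>x. x > 0 \<Longrightarrow>
      1 / real n * (\<Sum>k=1..n. \<P>(\<omega> in N. \<bar>X k \<omega>\<bar> > x)) \<le> M * \<P>(\<omega> in N'. \<bar>Y \<omega>\<bar> > x)"
  shows "(\<Sum>k=1..n. \<integral>\<^sup>+\<omega>. ennreal (min 1 ((X k \<omega>)\<^sup>2 / c)) \<partial>N)
    \<le> ennreal (M * real n) * (\<integral>\<^sup>+\<omega>. ennreal (min 1 ((Y \<omega>)\<^sup>2 / c)) \<partial>N')"
proof -
  let ?t = "\<lambda>k t. ennreal (measure N {\<omega> \<in> space N. \<bar>X k \<omega>\<bar> > sqrt (c * t)}) * indicator {0<..<1} t"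
  let ?y = "\<lambda>t. ennreal (measure N' {\<omega> \<in> space N'. \<bar>Y \<omega>\<bar> > sqrt (c * t)}) * indicator {0<..<1} t"
  \<comment> \<open>The fresh type \<open>'c\<close> lets this fact serve both \<open>N\<close> and
    \<open>N'\<close>, whose sample spaces may differ.\<close>
  have tail_meas: "(\<lambda>t. ennreal (measure N'' {\<omega> \<in> space N''. \<bar>Z \<omega>\<bar> > sqrt (c * t)})
      * indicator {0<..<1} t) \<in> borel_measurable lborel"
    if "prob_space N''" and [measurable]: "Z \<in> borel_measurable N''" for N'' :: "'c measure" and Z
  proof -
    interpret prob_space N'' by fact
    show ?thesis by measurable
  qed
  have "(\<Sum>k=1..n. \<integral>\<^sup>+\<omega>. ennreal (min 1 ((X k \<omega>)\<^sup>2 / c)) \<partial>N) = (\<Sum>k=1..n. \<integral>\<^sup>+t. ?t k t \<partial>lborel)"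
    using \<open>c > 0\<close> X by (intro sum.cong nn_integral_truncated_square N) auto
  also have "\<dots> = (\<integral>\<^sup>+t. (\<Sum>k=1..n. ?t k t) \<partial>lborel)"
    using X by (intro nn_integral_sum[symmetric] tail_meas N) auto
  also have "\<dots> \<le> (\<integral>\<^sup>+t. ennreal (M * real n) * ?y t \<partial>lborel)"
  proof (intro nn_integral_mono)
    fix t :: real
    show "(\<Sum>k=1..n. ?t k t) \<le> ennreal (M * real n) * ?y t"
    proof (cases "t \<in> {0<..<1}")
      case True
      then have "(\<Sum>k=1..n. \<P>(\<omega> in N. \<bar>X k \<omega>\<bar> > sqrt (c * t)))
          \<le> M * real n * \<P>(\<omega> in N'. \<bar>Y \<omega>\<bar> > sqrt (c * t))"
        using dom[of "sqrt (c * t)"] \<open>c > 0\<close> \<open>n \<ge> 1\<close> by (simp add: field_simps)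
      then have "ennreal (\<Sum>k=1..n. \<P>(\<omega> in N. \<bar>X k \<omega>\<bar> > sqrt (c * t)))
          \<le> ennreal (M * real n) * ennreal (\<P>(\<omega> in N'. \<bar>Y \<omega>\<bar> > sqrt (c * t)))"
        using \<open>M > 0\<close> by (simp add: ennreal_leI flip: ennreal_mult)
      then show ?thesis
        using True by simp
    qed simp
  qed
  also have "\<dots> = ennreal (M * real n) * (\<integral>\<^sup>+t. ?y t \<partial>lborel)"
    by (intro nn_integral_cmult tail_meas N' Y)
  also have "(\<integral>\<^sup>+t. ?y t \<partial>lborel) = (\<integral>\<^sup>+\<omega>. ennreal (min 1 ((Y \<omega>)\<^sup>2 / c)) \<partial>N')"
    using \<open>c > 0\<close> by (intro nn_integral_truncated_square[symmetric] N' Y)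
  finally show ?thesis .
qed

section \<open>Dyadic sums\<close>

text \<open>
  The two cases make the induction close: halving \<open>w\<close> removes the leading summand and doubles the
  rest, so the slack \<open>2 * w - 1\<close> absorbs the summand \<open>1\<close>.
\<close>

lemma dyadic_sum_le_aux:
  fixes q w :: real
  assumes q: "q > 1"
  defines "C \<equiv> 1 / (1 - 2 powr (1 - q))"
  shows "0 \<le> w \<Longrightarrow> (\<Sum>j<m. 2 ^ j * min 1 ((w / 2 ^ j) powr q))
    \<le> (if w < 1 then C * w else C * w + 2 * w - 1)"
proof (induction m arbitrary: w)
  case 0
  have "2 powr (1 - q) < 1"
    using q by (simp add: powr_less_one)
  then have "C \<ge> 0" by (simp add: C_def)
  then have "C * w \<ge> 0" using 0 by simp
  then show ?case by simp
next
  case (Suc m)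
  \<comment> \<open>The ratio of the geometric series that dominates the sum when
    \<open>w < 1\<close>; then \<open>C = 1 / (1 - r)\<close>.\<close>
  define r :: real where "r = 2 powr (1 - q)"
  have r: "0 < r" "r < 1"
    using q by (auto simp: r_def powr_less_one)
  show ?case
  proof (cases "w < 1")
    case True
    \<comment> \<open>Here the truncation is dropped, and \<open>w powr q \<le> w\<close> makes the
      bound linear in \<open>w\<close>.\<close>
    have "2 ^ j * min 1 ((w / 2 ^ j) powr q) \<le> w * r ^ j" for j
    proof -
      have "2 ^ j * min 1 ((w / 2 ^ j) powr q) \<le> 2 ^ j * (w / 2 ^ j) powr q"
        by simp
      also have "\<dots> = w powr q * r ^ j"
        using Suc.prems
        by (simp add: r_def powr_divide powr_diff power_divide powr_realpow[symmetric] powr_powr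
            mult.commute)
      also have "w powr q \<le> w"
        using powr_mono'[of 1 q w] True Suc.prems q by simp
      finally show ?thesis
        using Suc.prems r by (simp add: mult_right_mono)
    qed
    then have "(\<Sum>j<Suc m. 2 ^ j * min 1 ((w / 2 ^ j) powr q)) \<le> (\<Sum>j<Suc m. w * r ^ j)"
      by (intro sum_mono)
    also have "\<dots> = w * ((1 - r ^ Suc m) / (1 - r))"
      using r by (simp only: sum_distrib_left[symmetric] sum_gp_strict) simp
    also have "\<dots> \<le> w * (1 / (1 - r))"
      using r Suc.prems by (intro mult_left_mono divide_right_mono) auto
    finally show ?thesis
      using True by (simp add: C_def r_def)
  next
    case False
    have "(\<Sum>j<Suc m. 2 ^ j * min 1 ((w / 2 ^ j) powr q))
        = min 1 (w powr q) + 2 * (\<Sum>j<m. 2 ^ j * min 1 ((w / 2 / 2 ^ j) powr q))"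
      by (subst sum.lessThan_Suc_shift) (simp add: sum_distrib_left mult.assoc)
    also have "\<dots> \<le> 1 + 2 * (if w / 2 < 1 then C * (w / 2) else C * (w / 2) + 2 * (w / 2) - 1)"
      using Suc.IH[of "w / 2"] Suc.prems by (intro add_mono mult_left_mono) auto
    \<comment> \<open>If \<open>w / 2 < 1\<close> this uses \<open>w \<ge> 1\<close>; otherwise both
      sides are equal.\<close>
    also have "\<dots> \<le> C * w + 2 * w - 1"
      using False by (auto simp: field_simps)
    finally show ?thesis
      using False by simp
  qed
qed

text \<open>Both cases of the sharper bound are merged into one that is linear in \<open>w\<close>
  and uniform in \<open>m\<close>. Linearity is what makes a first moment of \<open>w\<close>
  suffice later.\<close>

lemma dyadic_sum_le:
  fixes q w :: real
  assumes "q > 1" "0 \<le> w"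
  shows "(\<Sum>j<m. 2 ^ j * min 1 ((w / 2 ^ j) powr q)) \<le> (1 / (1 - 2 powr (1 - q)) + 2) * w"
  by (rule order_trans[OF dyadic_sum_le_aux[OF assms]])
    (use assms(2) in \<open>simp add: distrib_right del: times_divide_eq_left\<close>)

text \<open>Put \<open>w = \<bar>y\<bar> powr p\<close> and \<open>q = 2 / p\<close> in the dyadic
  bound: the quotient inside the truncation becomes \<open>(w / 2 ^ j) powr q\<close>, and a bound
  linear in \<open>w\<close> is a multiple of \<open>\<bar>y\<bar> powr p\<close>.\<close>

lemma suminf_truncated_square_le:
  fixes y p :: real
  assumes p: "0 < p" "p < 2"
  defines "C \<equiv> 1 / (1 - 2 powr (1 - 2 / p)) + 2"
  shows "(\<Sum>j. ennreal (2 ^ j) * ennreal (min 1 (y\<^sup>2 / (2 powr (2 / p)) ^ j))) \<le> ennreal (C * \<bar>y\<bar> powr p)"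
proof (rule suminf_le_const)
  fix m
  have eq: "y\<^sup>2 / (2 powr (2 / p)) ^ j = (\<bar>y\<bar> powr p / 2 ^ j) powr (2 / p)" for j
  proof -
    have "(\<bar>y\<bar> powr p / 2 ^ j) powr (2 / p) = \<bar>y\<bar> powr 2 / (2 ^ j) powr (2 / p)"
      using p by (simp add: powr_divide powr_powr)
    moreover have "\<bar>y\<bar> powr 2 = y\<^sup>2"
      by (cases "y = 0") (auto simp: powr_numeral)
    moreover have "(2 ^ j) powr (2 / p) = (2 powr (2 / p)) ^ j"
      by (simp add: powr_realpow[symmetric] powr_powr mult.commute)
    ultimately show ?thesis by simp
  qed
  have "(\<Sum>j<m. ennreal (2 ^ j) * ennreal (min 1 (y\<^sup>2 / (2 powr (2 / p)) ^ j)))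
      = ennreal (\<Sum>j<m. 2 ^ j * min 1 ((\<bar>y\<bar> powr p / 2 ^ j) powr (2 / p)))"
    by (simp add: eq flip: ennreal_mult)
  also have "\<dots> \<le> ennreal (C * \<bar>y\<bar> powr p)"
    unfolding C_def using p by (intro ennreal_leI dyadic_sum_le) auto
  finally show "(\<Sum>j<m. ennreal (2 ^ j) * ennreal (min 1 (y\<^sup>2 / (2 powr (2 / p)) ^ j)))
      \<le> ennreal (C * \<bar>y\<bar> powr p)" .
qed simp

text \<open>Indices between consecutive powers of \<open>2\<close> cost a factor \<open>2 powr q\<close>.\<close>

lemma sum_squares_tendsto_0_of_dyadic:
  fixes x :: "nat \<Rightarrow> real" and q :: real
  assumes q: "q > 0"
    and lim: "(\<lambda>j. \<Sum>k=1..2^j. min 1 ((x k)\<^sup>2 / (2 powr q) ^ j)) \<longlonglongrightarrow> 0"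
  shows "(\<lambda>n. real n powr (-q) * (\<Sum>k=1..n. (x k)\<^sup>2)) \<longlonglongrightarrow> 0"
proof (rule LIMSEQ_I)
  fix e :: real assume "e > 0"
  \<comment> \<open>The cap 1 rules out truncated terms; the other bound pays in advance for the
    factor \<open>2 powr q\<close>.\<close>
  define \<delta> where "\<delta> = min 1 (e / 2 powr q)"
  have "\<delta> > 0" using \<open>e > 0\<close> by (simp add: \<delta>_def)
  then obtain J where J: "\<And>j. j \<ge> J \<Longrightarrow> \<bar>\<Sum>k=1..2^j. min 1 ((x k)\<^sup>2 / (2 powr q) ^ j)\<bar> < \<delta>"
    using LIMSEQ_D[OF lim] by auto
  have "norm (real n powr (-q) * (\<Sum>k=1..n. (x k)\<^sup>2) - 0) < e" if n: "n \<ge> 2 ^ J" for n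
  proof -
    have "n \<ge> 1" using n by (metis le_trans one_le_numeral one_le_power)
    then obtain i where i: "2 ^ i \<le> n" "n < 2 ^ (i + 1)"
      using ex_power_ivl1[of 2 n] by auto
    \<comment> \<open>The block of level \<open>j\<close> contains all indices up to
      \<open>n\<close>, while \<open>n\<close> is still at least \<open>2 ^ i\<close>.\<close>
    define j where "j = i + 1"
    have "(2::nat) ^ J < 2 ^ j"
      using n i unfolding j_def by linarith
    then have "J \<le> j" by (simp add: less_imp_le)
    let ?c = "(2 powr q) ^ j"
    have U: "(\<Sum>k=1..2^j. min 1 ((x k)\<^sup>2 / ?c)) < \<delta>"
      using J[OF \<open>J \<le> j\<close>] by linarith
    \<comment> \<open>The summands are nonnegative, so a sum below 1 keeps each minimum below
      1.\<close>
    have untruncated: "min 1 ((x k)\<^sup>2 / ?c) = (x k)\<^sup>2 / ?c" if "k \<in> {1..2^j}" for k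
    proof -
      have "min 1 ((x k)\<^sup>2 / ?c) \<le> (\<Sum>k=1..2^j. min 1 ((x k)\<^sup>2 / ?c))"
        using that by (intro member_le_sum) auto
      also have "\<dots> < 1" using U by (simp add: \<delta>_def)
      finally show ?thesis by linarith
    qed
    have "(2 powr q) ^ i = (2 ^ i) powr q"
      by (simp add: powr_realpow[symmetric] powr_powr mult.commute)
    also have "\<dots> \<le> real n powr q"
      using i(1) q by (intro powr_mono2) (auto simp flip: of_nat_power)
    finally have low: "(2 powr q) ^ i \<le> real n powr q" .
    have "real n powr (-q) * (\<Sum>k=1..n. (x k)\<^sup>2) = (\<Sum>k=1..n. (x k)\<^sup>2) / real n powr q"
      by (simp add: powr_minus divide_inverse mult.commute)
    \<comment> \<open>The numerator grows to level \<open>j\<close> and the denominator shrinks to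
      level \<open>i = j - 1\<close>; this mismatch of one level is the source of
      \<open>2 powr q\<close>.\<close>
    also have "\<dots> \<le> (\<Sum>k=1..2^j. (x k)\<^sup>2) / (2 powr q) ^ i"
      using i low by (intro frac_le sum_mono2 sum_nonneg) (auto simp: j_def)
    also have "\<dots> = 2 powr q * (\<Sum>k=1..2^j. (x k)\<^sup>2 / ?c)"
      by (simp add: j_def sum_divide_distrib sum_distrib_left)
    also have "(\<Sum>k=1..2^j. (x k)\<^sup>2 / ?c) = (\<Sum>k=1..2^j. min 1 ((x k)\<^sup>2 / ?c))"
      by (intro sum.cong refl untruncated[symmetric])
    also have "2 powr q * \<dots> < 2 powr q * \<delta>"
      using U by simp
    also have "\<dots> \<le> e"
      by (simp add: \<delta>_def min_def field_simps)
    finally show ?thesis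
      by (simp add: sum_nonneg)
  qed
  then show "\<exists>n0. \<forall>n\<ge>n0. norm (real n powr (-q) * (\<Sum>k=1..n. (x k)\<^sup>2) - 0) < e"
    by blast
qed

section \<open>Almost sure convergence\<close>

text \<open>The sums \<open>U j\<close> have summable expectations, so their series converges almost
  surely and its terms tend to 0. The deterministic dyadic criterion then applies to each such
  sample point.\<close>

lemma AE_sum_squares_tendsto_0:
  fixes X :: "nat \<Rightarrow> 'a \<Rightarrow> real" and Y :: "'b \<Rightarrow> real" and M p :: real
  assumes N: "prob_space N" and X: "\<And>k. k \<ge> 1 \<Longrightarrow> X k \<in> borel_measurable N"
    and N': "prob_space N'" and Y [measurable]: "Y \<in> borel_measurable N'"
    and M: "M > 0"
    and dom: "\<And>x n. x > 0 \<Longrightarrow> n \<ge> 1 \<Longrightarrow>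
      1 / real n * (\<Sum>k=1..n. \<P>(\<omega> in N. \<bar>X k \<omega>\<bar> > x)) \<le> M * \<P>(\<omega> in N'. \<bar>Y \<omega>\<bar> > x)"
    and p: "0 < p" "p < 2"
    and int: "integrable N' (\<lambda>\<omega>. \<bar>Y \<omega>\<bar> powr p)"
  shows "AE \<omega> in N. (\<lambda>n. real n powr (- (2 / p)) * (\<Sum>k=1..n. (X k \<omega>)\<^sup>2)) \<longlonglongrightarrow> 0"
proof -
  define c where "c j = (2 powr (2 / p)) ^ j" for j :: nat
  define C where "C = 1 / (1 - 2 powr (1 - 2 / p)) + 2"
  define U where "U j \<omega> = (\<Sum>k=1..2^j. min 1 ((X k \<omega>)\<^sup>2 / c j))" for j \<omega>
  have c: "c j > 0" for j by (simp add: c_def)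
  have U_nonneg: "U j \<omega> \<ge> 0" for j \<omega>
    unfolding U_def using c[of j] by (intro sum_nonneg) auto
  have trunc_meas: "(\<lambda>\<omega>. min 1 ((X k \<omega>)\<^sup>2 / c j)) \<in> borel_measurable N" if "k \<ge> 1" for j k
    using X[OF that] by measurable
  have U_meas [measurable]: "U j \<in> borel_measurable N" for j
    unfolding U_def using trunc_meas by (intro borel_measurable_sum) auto
  \<comment> \<open>The number \<open>2 ^ j\<close> of summands becomes the weight in the dyadic
    series for \<open>Y\<close>.\<close>
  have EU: "(\<integral>\<^sup>+\<omega>. ennreal (U j \<omega>) \<partial>N)
      \<le> ennreal M * (\<integral>\<^sup>+\<omega>. ennreal (2 ^ j) * ennreal (min 1 ((Y \<omega>)\<^sup>2 / c j)) \<partial>N')" for j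
  proof -
    have "(\<integral>\<^sup>+\<omega>. ennreal (U j \<omega>) \<partial>N)
        = (\<integral>\<^sup>+\<omega>. (\<Sum>k=1..2^j. ennreal (min 1 ((X k \<omega>)\<^sup>2 / c j))) \<partial>N)"
      unfolding U_def using c[of j] by (intro nn_integral_cong sum_ennreal[symmetric]) auto
    also have "\<dots> = (\<Sum>k=1..2^j. \<integral>\<^sup>+\<omega>. ennreal (min 1 ((X k \<omega>)\<^sup>2 / c j)) \<partial>N)"
      using trunc_meas by (intro nn_integral_sum measurable_compose[OF _ measurable_ennreal]) auto
    also have "\<dots> \<le> ennreal (M * real (2 ^ j)) * (\<integral>\<^sup>+\<omega>. ennreal (min 1 ((Y \<omega>)\<^sup>2 / c j)) \<partial>N')"
      by (rule sum_truncated_square_le[OF N X N' Y M _ c dom]) simp_all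
    also have "\<dots> = ennreal M * (\<integral>\<^sup>+\<omega>. ennreal (2 ^ j) * ennreal (min 1 ((Y \<omega>)\<^sup>2 / c j)) \<partial>N')"
      using M by (simp add: ennreal_mult nn_integral_cmult mult.assoc)
    finally show ?thesis .
  qed
  have C: "C \<ge> 0"
  proof -
    have "2 powr (1 - 2 / p) < 1"
      using p by (simp add: powr_less_one)
    then show ?thesis by (simp add: C_def)
  qed
  have "(\<integral>\<^sup>+\<omega>. (\<Sum>j. ennreal (U j \<omega>)) \<partial>N) = (\<Sum>j. \<integral>\<^sup>+\<omega>. ennreal (U j \<omega>) \<partial>N)"
    by (intro nn_integral_suminf) measurable
  also have "\<dots> \<le> (\<Sum>j. ennreal M * (\<integral>\<^sup>+\<omega>. ennreal (2 ^ j) * ennreal (min 1 ((Y \<omega>)\<^sup>2 / c j)) \<partial>N'))"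
    by (intro suminf_le EU) auto
  \<comment> \<open>Summing over \<open>j\<close> inside the integral allows the pointwise dyadic
    bound to be used at each value of \<open>Y\<close>.\<close>
  also have "\<dots> = ennreal M * (\<integral>\<^sup>+\<omega>. (\<Sum>j. ennreal (2 ^ j) * ennreal (min 1 ((Y \<omega>)\<^sup>2 / c j))) \<partial>N')"
    by (subst nn_integral_suminf) (auto intro: ennreal_suminf_cmult)
  also have "\<dots> \<le> ennreal M * (\<integral>\<^sup>+\<omega>. ennreal (C * \<bar>Y \<omega>\<bar> powr p) \<partial>N')"
    unfolding C_def c_def
    by (intro mult_left_mono nn_integral_mono suminf_truncated_square_le p) auto
  also have "\<dots> = ennreal M * ennreal (\<integral>\<omega>. C * \<bar>Y \<omega>\<bar> powr p \<partial>N')"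
    using int C by (subst nn_integral_eq_integral) auto
  also have "\<dots> < \<infinity>"
    by (simp add: ennreal_mult_less_top)
  finally have "(\<integral>\<^sup>+\<omega>. (\<Sum>j. ennreal (U j \<omega>)) \<partial>N) \<noteq> \<infinity>"
    by simp
  then have "AE \<omega> in N. (\<Sum>j. ennreal (U j \<omega>)) \<noteq> \<infinity>"
    by (intro nn_integral_PInf_AE) measurable
  then show ?thesis
  proof eventually_elim
    case (elim \<omega>)
    then have "summable (\<lambda>j. U j \<omega>)"
      using U_nonneg by (intro summable_suminf_not_top) auto
    then have "(\<lambda>j. U j \<omega>) \<longlonglongrightarrow> 0"
      by (rule summable_LIMSEQ_zero)
    then show ?case
      using p unfolding U_def c_def by (intro sum_squares_tendsto_0_of_dyadic) auto
  qed
qed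

theorem corollary3p1:
  fixes P\<^sub>X :: "'a measure" and X :: "nat \<Rightarrow> 'a \<Rightarrow> real"
    and P\<^sub>Y :: "'b measure" and Y :: "'b \<Rightarrow> real"
    and P\<^sub>\<theta> :: "nat \<Rightarrow> (nat \<Rightarrow> real) measure"
    and M p :: real
  assumes "prob_space P\<^sub>X" and "\<And>k. k \<ge> 1 \<Longrightarrow> X k \<in> borel_measurable P\<^sub>X"
    and "prob_space P\<^sub>Y" and "Y \<in> borel_measurable P\<^sub>Y"
    and "\<And>n. n \<ge> 2 \<Longrightarrow> uniform_on_sphere n (P\<^sub>\<theta> n)"
    and "M > 0"
    and "\<And>x n. x > 0 \<Longrightarrow> n \<ge> 1 \<Longrightarrow>
           1 / real n * (\<Sum>k=1..n. \<P>(\<omega> in P\<^sub>X. \<bar>X k \<omega>\<bar> > x)) \<le> M * \<P>(\<omega> in P\<^sub>Y. \<bar>Y \<omega>\<bar> > x)"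
    and "1 \<le> p" and "p < 2"
    and "integrable P\<^sub>Y (\<lambda>\<omega>. \<bar>Y \<omega>\<bar> powr p)"
  shows "AE \<omega> in P\<^sub>X.
           (\<lambda>n. real n powr (1/2 - 1/p) * (\<integral>u. \<bar>weighted_sum X n u \<omega>\<bar> \<partial>P\<^sub>\<theta> n)) \<longlonglongrightarrow> 0"
proof -
  have "AE \<omega> in P\<^sub>X. (\<lambda>n. real n powr (- (2 / p)) * (\<Sum>k=1..n. (X k \<omega>)\<^sup>2)) \<longlonglongrightarrow> 0"
    using assms by (intro AE_sum_squares_tendsto_0[where Y = Y and N' = P\<^sub>Y and M = M]) auto
  then show ?thesis
  proof eventually_elim
    case (elim \<omega>)
    let ?Q = "\<lambda>n. real n powr (- (2 / p)) * (\<Sum>k=1..n. (X k \<omega>)\<^sup>2)"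
    let ?E = "\<lambda>n. real n powr (1/2 - 1/p) * (\<integral>u. \<bar>weighted_sum X n u \<omega>\<bar> \<partial>P\<^sub>\<theta> n)"
    have "(\<lambda>n. sqrt (?Q n)) \<longlonglongrightarrow> 0"
      using tendsto_real_sqrt[OF elim] by simp
    moreover have "\<forall>\<^sub>F n in sequentially. ?E n \<le> sqrt (?Q n)"
      \<comment> \<open>Uniformity of \<open>P\<^sub>\<theta> n\<close> is assumed from dimension 2
        on.\<close>
      using eventually_ge_at_top[of 2]
    proof eventually_elim
      case (elim n)
      have "?E n \<le> real n powr (1/2 - 1/p) * sqrt ((\<Sum>k=1..n. (X k \<omega>)\<^sup>2) / real n)"
        unfolding weighted_sum_def
        using first_moment_uniform_le[OF assms(5)[OF elim]] by (intro mult_left_mono) auto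
      also have "\<dots> = sqrt (?Q n)"
      proof -
        \<comment> \<open>Moved under the root, the prefactor is
          \<open>n * n powr (- (2 / p))\<close>; its factor \<open>n\<close> cancels the
          \<open>1 / n\<close> of the second moment.\<close>
        have "real n powr (1/2 - 1/p) = (real n powr (1 - 2/p)) powr (1/2)"
          by (simp add: powr_powr diff_divide_distrib)
        also have "\<dots> = sqrt (real n * real n powr (- (2 / p)))"
          using elim powr_add[of "real n" 1 "- (2 / p)"] by (simp add: powr_half_sqrt)
        finally show ?thesis
          using elim by (simp flip: real_sqrt_mult)
      qed
      finally show ?case .
    qed
    moreover have "\<forall>\<^sub>F n in sequentially. 0 \<le> ?E n"
      by (intro always_eventually allI mult_nonneg_nonneg integral_nonneg) auto
    ultimately show ?case
      using tendsto_sandwich[of "\<lambda>_. 0" ?E sequentially "\<lambda>n. sqrt (?Q n)" 0] by auto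
  qed
qed

end
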